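(* Let $f$ be a transcendental entire function, or a transcendental meromorphic function on $\mathbb{C}$, and let $s\in S(f)$ be a finite singular value of $f$. Let $U\subset\mathbb{C}$ be an open neighbourhood of $s$. Suppose that $\rho(z)|dz|$ is a conformal metric defined on $V:=f^{-1}(U)$ such that $\operatorname{dist}_\rho(z,\infty)=\infty$ for all $z\in V$. Then $$\inf_{z\in V}\frac{|f'(z)|}{\rho(z)}=0.$$
   Context: Singular values: $s\in\mathbb{C}$ is a regular value of $f$ if there is an open neighbourhood $U$ of $s$ such that for every connected component $V$ of $f^{-1}(U)$ the map $f\colon V\to U$ is a conformal isomorphism; otherwise $s$ is a singular value. $S(f)$ denotes the set of (finite) singular values; equivalently, it is the closure in $\mathbb{C}$ of the set of finite critical and asymptotic values of $f$. Conformal metric: a conformal metric on an open set $V\subset\mathbb{C}$ is $\rho(z)|dz|$ with $\rho\colon V\to(0,\infty)$ continuous. For $z,w\in V$, $\operatorname{dist}_\rho(z,w)$ is the infimum of $\rho$-lengths of curves in $V$ connecting $z$ and $w$ ($+\infty$ if they lie in different components of $V$), and $\operatorname{dist}_\rho(z,\infty)=\liminf_{w\to\infty}\operatorname{dist}_\rho(z,w)$ (which is $+\infty$ if $V$ is bounded). *)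

theory Defs
  imports "HOL-Complex_Analysis.Complex_Analysis"
begin

definition transcendental_entire :: "(complex \<Rightarrow> complex) \<Rightarrow> bool" where
  "transcendental_entire f \<longleftrightarrow>
     f holomorphic_on UNIV \<and> \<not> (\<exists>p. \<forall>z. f z = poly p z)"

text \<open>
  A meromorphic function on the plane is represented by its normalised version: all
  removable singularities are filled in, and \<open>f z = 0\<close> is only a dummy value at a pole \<open>z\<close>.
\<close>

definition transcendental_meromorphic :: "(complex \<Rightarrow> complex) \<Rightarrow> bool" where
  "transcendental_meromorphic f \<longleftrightarrow>
     f nicely_meromorphic_on UNIV \<and>
     \<not> (\<exists>p q. q \<noteq> 0 \<and> (\<forall>z. poly q z \<noteq> 0 \<longrightarrow> f z = poly p z / poly q z))"

text \<open>
  The preimage of a set \<open>U\<close> of finite values. Poles are mapped to infinity, so they must be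
  excluded explicitly because of the dummy value \<open>0\<close>.
\<close>

definition mero_vimage :: "(complex \<Rightarrow> complex) \<Rightarrow> complex set \<Rightarrow> complex set" where
  "mero_vimage f U = {z. \<not> is_pole f z \<and> f z \<in> U}"

definition conformal_isomorphism ::
    "complex set \<Rightarrow> complex set \<Rightarrow> (complex \<Rightarrow> complex) \<Rightarrow> bool" where
  "conformal_isomorphism V U f \<longleftrightarrow>
     f holomorphic_on V \<and> f ` V \<subseteq> U \<and>
     (\<exists>g. g holomorphic_on U \<and> g ` U \<subseteq> V \<and>
          (\<forall>z\<in>V. g (f z) = z) \<and> (\<forall>w\<in>U. f (g w) = w))"

definition regular_value :: "(complex \<Rightarrow> complex) \<Rightarrow> complex \<Rightarrow> bool" where
  "regular_value f s \<longleftrightarrow>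
     (\<exists>U. open U \<and> s \<in> U \<and>
          (\<forall>V \<in> components (mero_vimage f U). conformal_isomorphism V U f))"

definition singular_values :: "(complex \<Rightarrow> complex) \<Rightarrow> complex set" where
  "singular_values f = {s. \<not> regular_value f s}"

definition conformal_metric_on :: "complex set \<Rightarrow> (complex \<Rightarrow> real) \<Rightarrow> bool" where
  "conformal_metric_on V \<rho> \<longleftrightarrow> continuous_on V \<rho> \<and> (\<forall>z\<in>V. \<rho> z > 0)"

text \<open>
  Curves are piecewise continuously differentiable. The library's \<^const>\<open>valid_path\<close> allows
  the derivative to be unbounded near the finitely many exceptional parameters, so such a curve
  may have infinite length. The Lebesgue integral with values in \<^typ>\<open>ennreal\<close> accounts for
  this, whereas the Henstock-Kurzweil \<^const>\<open>integral\<close> would return \<open>0\<close>.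
\<close>

definition metric_length :: "(complex \<Rightarrow> real) \<Rightarrow> (real \<Rightarrow> complex) \<Rightarrow> ennreal" where
  "metric_length \<rho> \<gamma> =
     (\<integral>\<^sup>+ t \<in> {0..1}. ennreal (\<rho> (\<gamma> t) * norm (vector_derivative \<gamma> (at t))) \<partial>lborel)"

text \<open>The infimum of the empty set is \<open>\<infinity>\<close>, as required for points in different components.\<close>

definition metric_dist ::
    "complex set \<Rightarrow> (complex \<Rightarrow> real) \<Rightarrow> complex \<Rightarrow> complex \<Rightarrow> ennreal" where
  "metric_dist V \<rho> z w =
     (INF \<gamma> \<in> {\<gamma>. valid_path \<gamma> \<and> path_image \<gamma> \<subseteq> V \<and> pathstart \<gamma> = z \<and> pathfinish \<gamma> = w}.
        metric_length \<rho> \<gamma>)"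

text \<open>
  The lower limit is over \<open>w \<rightarrow> \<infinity>\<close> with \<open>w \<in> V\<close>. For bounded \<open>V\<close> the filter is trivial and the
  value is \<open>\<infinity>\<close>.
\<close>

definition metric_dist_infinity ::
    "complex set \<Rightarrow> (complex \<Rightarrow> real) \<Rightarrow> complex \<Rightarrow> ennreal" where
  "metric_dist_infinity V \<rho> z =
     Liminf (inf at_infinity (principal V)) (\<lambda>w. metric_dist V \<rho> z w)"

end

theory Submission
  imports Defs
begin

text \<open>
  Suppose that the infimum is some \<open>c > 0\<close>, so that \<open>c * \<rho> \<le> \<bar>f'\<bar>\<close> on \<open>V\<close>. Then \<open>f\<close> has no
  critical points in \<open>V\<close>, and a curve in \<open>V\<close> whose image under \<open>f\<close> has Euclidean length \<open>L\<close> has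
  \<open>\<rho>\<close>-length at most \<open>L / c\<close>. Such a curve cannot escape to \<open>\<infinity>\<close>, because \<open>\<infinity>\<close> is infinitely far
  away; and it cannot leave \<open>V\<close> in the plane as long as its image stays in a compact subset of
  \<open>U\<close>, because \<open>f\<close> is large near a pole. Hence nothing obstructs the continuation of a branch of
  the inverse of \<open>f\<close> in a disc contained in \<open>U\<close>. It follows that \<open>f\<close> maps every component of the
  preimage of a small disc around \<open>s\<close> conformally onto that disc, so \<open>s\<close> is a regular value.

  The continuation is by discs rather than along paths. A branch \<open>g\<close> on a disc of radius \<open>r\<close> whose
  range lies in a compact subset of \<open>V\<close> is Lipschitz, so that \<open>f\<close> is injective on the closure
  of its range, hence near that closure; inverting \<open>f\<close> there gives a branch on a larger
  concentric disc (\<open>inverse_branch_extend\<close>). Since branches with the same base point agree, a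
  supremum over the admissible radii finishes the continuation (\<open>inverse_branch_exists\<close>). The
  metric enters only through \<open>metric_dist_inverse_branch_le\<close>, which compares the length of a
  lifted segment with the length of the segment, and \<open>bounded_metric_ball\<close>, which turns the bound
  on metric distances into one on Euclidean distances.
\<close>

section \<open>Injectivity near compact sets\<close>

text \<open>
  Two points with the same value that are both close to \<open>K\<close> are either close to one point of
  \<open>K\<close>, which local injectivity rules out, or close to two distinct points of \<open>K\<close> with
  almost equal values, which injectivity on \<open>K\<close> rules out. Compactness makes this uniform.
\<close>

lemma injective_near_compact:
  fixes f :: "complex \<Rightarrow> complex"
  assumes f: "f holomorphic_on V" and V: "open V" and K: "compact K" "K \<subseteq> V"
    and f': "\<And>z. z \<in> K \<Longrightarrow> deriv f z \<noteq> 0" and inj: "inj_on f K"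
  obtains N where "open N" "K \<subseteq> N" "N \<subseteq> V" "inj_on f N"
proof (cases "K = {}")
  case True
  then show ?thesis using that[of "{}"] by simp
next
  case False
  define N where "N = (\<lambda>n. V \<inter> {x. infdist x K < 1 / real (Suc n)})"
  have N_open: "open (N n)" for n
    unfolding N_def using V by (intro open_Int open_Collect_less continuous_intros)
  have K_N: "K \<subseteq> N n" for n
    using K by (auto simp: N_def)
  have "\<exists>n. inj_on f (N n)"
  proof (rule ccontr)
    assume "\<nexists>n. inj_on f (N n)"
    then have "\<forall>n. \<exists>x y. x \<in> N n \<and> y \<in> N n \<and> f x = f y \<and> x \<noteq> y"
      unfolding inj_on_def by blast
    then obtain u v where p: "\<And>n. u n \<in> N n" "\<And>n. v n \<in> N n"
      "\<And>n. f (u n) = f (v n)" "\<And>n. u n \<noteq> v n"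
      by metis
    have near: "\<exists>k\<in>K. dist x k < 1 / real (Suc n)" if "x \<in> N n" for x n
    proof -
      obtain k where "k \<in> K" "infdist x K = dist x k"
        using infdist_attains_inf[OF compact_imp_closed[OF K(1)] False] by metis
      then show ?thesis using that by (auto simp: N_def)
    qed
    obtain a where a: "\<And>n. a n \<in> K" "\<And>n. dist (u n) (a n) < 1 / real (Suc n)"
      using near[OF p(1)] by metis
    obtain b where b: "\<And>n. b n \<in> K" "\<And>n. dist (v n) (b n) < 1 / real (Suc n)"
      using near[OF p(2)] by metis
    have "seq_compact (K \<times> K)"
      using K compact_Times compact_imp_seq_compact by blast
    moreover have "\<forall>n. (a n, b n) \<in> K \<times> K"
      using a b by auto
    ultimately obtain l and r :: "nat \<Rightarrow> nat" where l: "l \<in> K \<times> K" "strict_mono r"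
        and lim: "((\<lambda>n. (a n, b n)) \<circ> r) \<longlonglongrightarrow> l"
      by (rule seq_compactE)
    obtain x y where xy: "l = (x, y)" by (cases l)
    have a_lim: "(\<lambda>n. a (r n)) \<longlonglongrightarrow> x"
      using tendsto_fst[OF lim] by (simp add: xy o_def)
    have b_lim: "(\<lambda>n. b (r n)) \<longlonglongrightarrow> y"
      using tendsto_snd[OF lim] by (simp add: xy o_def)
    have small: "(\<lambda>n. 1 / real (Suc (r n))) \<longlonglongrightarrow> 0"
      using LIMSEQ_subseq_LIMSEQ[OF LIMSEQ_Suc[OF lim_1_over_n] l(2)] by (simp add: o_def)
    have "(\<lambda>n. dist (u (r n)) (a (r n))) \<longlonglongrightarrow> 0"
      by (rule tendsto_sandwich[OF _ _ tendsto_const small])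
        (auto intro!: always_eventually less_imp_le a(2) simp del: of_nat_Suc)
    then have "(\<lambda>n. u (r n) - a (r n)) \<longlonglongrightarrow> 0"
      unfolding dist_norm by (rule tendsto_norm_zero_cancel)
    with a_lim have p_x: "(\<lambda>n. u (r n)) \<longlonglongrightarrow> x" by (rule Lim_transform)
    have "(\<lambda>n. dist (v (r n)) (b (r n))) \<longlonglongrightarrow> 0"
      by (rule tendsto_sandwich[OF _ _ tendsto_const small])
        (auto intro!: always_eventually less_imp_le b(2) simp del: of_nat_Suc)
    then have "(\<lambda>n. v (r n) - b (r n)) \<longlonglongrightarrow> 0"
      unfolding dist_norm by (rule tendsto_norm_zero_cancel)
    with b_lim have p_y: "(\<lambda>n. v (r n)) \<longlonglongrightarrow> y" by (rule Lim_transform)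
    have x: "x \<in> K" and y: "y \<in> K" using l xy by auto
    have "isCont f x" if "x \<in> K" for x
      using f V K that continuous_on_eq_continuous_at holomorphic_on_imp_continuous_on by blast
    then have "(\<lambda>n. f (u (r n))) \<longlonglongrightarrow> f x" "(\<lambda>n. f (v (r n))) \<longlonglongrightarrow> f y"
      using x y p_x p_y isCont_tendsto_compose by blast+
    then have "f x = f y"
      using p(3) LIMSEQ_unique by simp
    then have "x = y" using inj x y by (auto dest: inj_onD)
    obtain d where d: "d > 0" "inj_on f (ball x d)"
      using has_complex_derivative_locally_injective[OF f _ V f'[OF x]] x K by blast
    have "\<forall>\<^sub>F n in sequentially. u (r n) \<in> ball x d \<and> v (r n) \<in> ball x d"
      using topological_tendstoD[OF p_x open_ball, of x d] topological_tendstoD[OF p_y open_ball, of x d]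
        \<open>x = y\<close> d by (auto intro: eventually_conj)
    then obtain n where "u (r n) \<in> ball x d" "v (r n) \<in> ball x d"
      using eventually_happens by force
    then show False using inj_onD[OF d(2) p(3)] p(4) by blast
  qed
  then obtain n where "inj_on f (N n)" by blast
  then show ?thesis using that[OF N_open K_N] by (auto simp: N_def)
qed

section \<open>Branches of the inverse on discs\<close>

text \<open>
  A branch is indexed by its value \<open>z\<^sub>0\<close> at the centre \<open>f z\<^sub>0\<close> of its disc, because the centre
  alone does not determine it.
\<close>

definition inverse_branch ::
    "(complex \<Rightarrow> complex) \<Rightarrow> complex set \<Rightarrow> complex \<Rightarrow> real \<Rightarrow> (complex \<Rightarrow> complex) \<Rightarrow> bool" where
  "inverse_branch f V z\<^sub>0 r g \<longleftrightarrow>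
     g holomorphic_on ball (f z\<^sub>0) r \<and> g (f z\<^sub>0) = z\<^sub>0 \<and>
     (\<forall>w \<in> ball (f z\<^sub>0) r. g w \<in> V \<and> f (g w) = w)"

lemma inverse_branch_deriv:
  assumes f: "f holomorphic_on V" "open V" and g: "inverse_branch f V z\<^sub>0 r g"
    and w: "w \<in> ball (f z\<^sub>0) r"
  shows "deriv f (g w) * deriv g w = 1"
proof -
  have gd: "(g has_field_derivative deriv g w) (at w)"
    using g w by (auto simp: inverse_branch_def intro: holomorphic_derivI)
  have "(f has_field_derivative deriv f (g w)) (at (g w))"
    using f g w by (auto simp: inverse_branch_def intro: holomorphic_derivI)
  then have "(f \<circ> g has_field_derivative deriv f (g w) * deriv g w) (at w)"
    using gd by (rule DERIV_chain)
  then have "((\<lambda>w. w) has_field_derivative deriv f (g w) * deriv g w) (at w)"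
    by (rule has_field_derivative_transform_within_open[OF _ open_ball w])
      (use g in \<open>auto simp: inverse_branch_def\<close>)
  then show ?thesis
    using DERIV_ident DERIV_unique by blast
qed

text \<open>
  Near the centre both branches take values where \<open>f\<close> is injective, so they agree there; the
  identity theorem does the rest.
\<close>

lemma inverse_branch_unique:
  assumes f: "f holomorphic_on V" "open V" and f': "deriv f z\<^sub>0 \<noteq> 0" "z\<^sub>0 \<in> V"
    and r: "0 < r" "r \<le> r1" "r \<le> r2"
    and g1: "inverse_branch f V z\<^sub>0 r1 g1" and g2: "inverse_branch f V z\<^sub>0 r2 g2"
    and w: "w \<in> ball (f z\<^sub>0) r"
  shows "g1 w = g2 w"
proof -
  let ?B = "ball (f z\<^sub>0) r"
  have hol: "g1 holomorphic_on ?B" "g2 holomorphic_on ?B"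
    using g1 g2 r unfolding inverse_branch_def
    by (meson holomorphic_on_subset subset_ball)+
  obtain d where d: "d > 0" "inj_on f (ball z\<^sub>0 d)"
    using has_complex_derivative_locally_injective[OF f(1) _ f(2)] f' by blast
  define S where "S = (?B \<inter> g1 -` ball z\<^sub>0 d) \<inter> (?B \<inter> g2 -` ball z\<^sub>0 d)"
  have "open S" unfolding S_def
    by (intro open_Int continuous_open_preimage holomorphic_on_imp_continuous_on hol) auto
  moreover have "f z\<^sub>0 \<in> S"
    using g1 g2 d r by (auto simp: S_def inverse_branch_def)
  moreover have "g1 x = g2 x" if "x \<in> S" for x
    by (rule inj_onD[OF d(2)]) (use that g1 g2 r in \<open>auto simp: S_def inverse_branch_def\<close>)
  moreover have "S \<subseteq> ?B" by (auto simp: S_def)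
  ultimately show ?thesis
    by (intro analytic_continuation_open[OF \<open>open S\<close> open_ball _ connected_ball _ hol _ w]) auto
qed

lemma inverse_branch_small:
  assumes f: "f holomorphic_on V" "open V" and f': "deriv f z\<^sub>0 \<noteq> 0" "z\<^sub>0 \<in> V"
  obtains r g where "0 < r" "inverse_branch f V z\<^sub>0 r g"
proof -
  obtain d where d: "d > 0" "ball z\<^sub>0 d \<subseteq> V" "inj_on f (ball z\<^sub>0 d)"
    using has_complex_derivative_locally_injective[OF f(1) _ f(2)] f' by blast
  have hol: "f holomorphic_on ball z\<^sub>0 d" using f d holomorphic_on_subset by blast
  obtain g where g: "g holomorphic_on (f ` ball z\<^sub>0 d)" "\<And>z. z \<in> ball z\<^sub>0 d \<Longrightarrow> g (f z) = z"
    using holomorphic_has_inverse[OF hol open_ball d(3)] by metis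
  have "open (f ` ball z\<^sub>0 d)"
    using open_mapping_thm3[OF hol open_ball d(3)] .
  then obtain r where r: "r > 0" "ball (f z\<^sub>0) r \<subseteq> f ` ball z\<^sub>0 d"
    using d(1) by (metis centre_in_ball imageI openE)
  have "inverse_branch f V z\<^sub>0 r g"
    unfolding inverse_branch_def
    using g r d by (fastforce intro: holomorphic_on_subset)
  with r that show ?thesis by blast
qed

text \<open>
  On \<open>K\<close> the derivative of \<open>f\<close> is bounded away from \<open>0\<close>, so \<open>g\<close> is Lipschitz. In the limit this
  says that \<open>f\<close> expands distances on the closure \<open>L\<close> of the range of \<open>g\<close> by a definite factor and
  is therefore injective on \<open>L\<close>. Then \<open>f\<close> is injective on an open \<open>N\<close> containing \<open>L\<close>, and \<open>f ` N\<close> is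
  open and contains the closed disc \<open>f ` L\<close>, hence a larger disc.
\<close>

lemma inverse_branch_extend:
  assumes f: "f holomorphic_on V" "open V" and f': "\<And>z. z \<in> V \<Longrightarrow> deriv f z \<noteq> 0"
    and r: "0 < r" and g: "inverse_branch f V z\<^sub>0 r g"
    and K: "compact K" "K \<subseteq> V" "g ` ball (f z\<^sub>0) r \<subseteq> K"
  obtains r' h where "r < r'" "inverse_branch f V z\<^sub>0 r' h"
proof -
  let ?B = "ball (f z\<^sub>0) r"
  have gB: "g w \<in> K" "f (g w) = w" if "w \<in> ?B" for w
    using that g K by (auto simp: inverse_branch_def)
  have z0: "z\<^sub>0 \<in> g ` ?B"
    using g r by (metis inverse_branch_def centre_in_ball imageI)
  define L where "L = closure (g ` ?B)"
  have L: "L \<subseteq> K" "L \<subseteq> V" "compact L"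
  proof -
    show "L \<subseteq> K" unfolding L_def using K by (simp add: closure_minimal compact_imp_closed)
    then show "L \<subseteq> V" using K by blast
    show "compact L"
      using \<open>L \<subseteq> K\<close> K(1) unfolding L_def
      by (metis closed_closure compact_Int_closed inf.absorb2 )
  qed
  have "continuous_on K (\<lambda>z. norm (deriv f z))"
    using f K by (intro continuous_intros holomorphic_on_imp_continuous_on)
      (meson holomorphic_deriv holomorphic_on_subset)
  then obtain k where k: "k \<in> K" "\<And>z. z \<in> K \<Longrightarrow> norm (deriv f k) \<le> norm (deriv f z)"
    using continuous_attains_inf[OF K(1)] z0 K(3) by (metis empty_iff subsetD)
  define \<delta> where "\<delta> = norm (deriv f k)"
  have \<delta>: "\<delta> > 0" "\<And>z. z \<in> K \<Longrightarrow> \<delta> \<le> norm (deriv f z)"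
    using k f' K by (auto simp: \<delta>_def)
  have lip: "norm (g u - g v) \<le> 1 / \<delta> * norm (u - v)" if "u \<in> ?B" "v \<in> ?B" for u v
  proof (rule field_differentiable_bound[OF convex_ball _ _ that])
    fix w assume w: "w \<in> ?B"
    show "(g has_field_derivative deriv g w) (at w within ?B)"
      using g w unfolding inverse_branch_def
      by (meson holomorphic_derivI has_field_derivative_at_within open_ball)
    have "norm (deriv f (g w)) * norm (deriv g w) = 1"
      using inverse_branch_deriv[OF f g w] by (metis norm_mult norm_one)
    then have "\<delta> * norm (deriv g w) \<le> 1"
      using \<delta>(2)[OF gB(1)[OF w]] by (metis mult_right_mono norm_ge_zero)
    then show "norm (deriv g w) \<le> 1 / \<delta>"
      using \<delta>(1) by (simp add: field_simps)
  qed
  have cont_f: "continuous_on L f"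
    using f L holomorphic_on_imp_continuous_on holomorphic_on_subset by blast
  have contra: "norm (x - y) \<le> 1 / \<delta> * norm (f x - f y)" if "x \<in> L" "y \<in> L" for x y
  proof -
    obtain a where a: "\<And>n. a n \<in> g ` ?B" "a \<longlonglongrightarrow> x"
      using \<open>x \<in> L\<close> unfolding L_def closure_sequential by auto
    obtain b where b: "\<And>n. b n \<in> g ` ?B" "b \<longlonglongrightarrow> y"
      using \<open>y \<in> L\<close> unfolding L_def closure_sequential by auto
    have ab: "norm (a n - b n) \<le> 1 / \<delta> * norm (f (a n) - f (b n))" for n
      using a(1)[of n] b(1)[of n] lip gB(2) by auto
    have "isCont f x" if "x \<in> L" for x
      using f L that continuous_on_eq_continuous_at holomorphic_on_imp_continuous_on by blast
    then have "(\<lambda>n. f (a n)) \<longlonglongrightarrow> f x" "(\<lambda>n. f (b n)) \<longlonglongrightarrow> f y"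
      using \<open>x \<in> L\<close> \<open>y \<in> L\<close> a(2) b(2) isCont_tendsto_compose by blast+
    then have "(\<lambda>n. 1 / \<delta> * norm (f (a n) - f (b n))) \<longlonglongrightarrow> 1 / \<delta> * norm (f x - f y)"
      by (intro tendsto_intros)
    moreover have "(\<lambda>n. norm (a n - b n)) \<longlonglongrightarrow> norm (x - y)"
      using a(2) b(2) by (intro tendsto_intros)
    ultimately show ?thesis using ab by (blast intro: LIMSEQ_le)
  qed
  have inj: "inj_on f L"
    using contra by (intro inj_onI) force
  obtain N where N: "open N" "L \<subseteq> N" "N \<subseteq> V" "inj_on f N"
    using injective_near_compact[OF f L(3,2) f' inj] L by blast
  have hol: "f holomorphic_on N" using f N holomorphic_on_subset by blast
  have "?B \<subseteq> f ` L"
  proof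
    fix w assume "w \<in> ?B"
    then show "w \<in> f ` L"
      using gB(2)[of w] closure_subset[of "g ` ?B"] unfolding L_def
      by (intro image_eqI[of _ _ "g w"]) auto
  qed
  then have "cball (f z\<^sub>0) r \<subseteq> f ` L"
    using closure_minimal[of ?B "f ` L"] compact_continuous_image[OF cont_f L(3)] r
    by (simp add: compact_imp_closed closure_ball)
  then have sub: "cball (f z\<^sub>0) r \<subseteq> f ` N" using N by blast
  have "open (f ` N)" using open_mapping_thm3[OF hol N(1,4)] .
  then obtain e where e: "e > 0" "(\<Union>x\<in>cball (f z\<^sub>0) r. ball x e) \<subseteq> f ` N"
    using compact_subset_open_imp_ball_epsilon_subset[OF compact_cball _ sub] by blast
  obtain h where h: "h holomorphic_on (f ` N)" "\<And>z. z \<in> N \<Longrightarrow> h (f z) = z"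
    using holomorphic_has_inverse[OF hol N(1,4)] by metis
  have ball: "ball (f z\<^sub>0) (r + e) \<subseteq> f ` N"
  proof
    fix w assume w: "w \<in> ball (f z\<^sub>0) (r + e)"
    have "w \<in> (\<Union>x\<in>cball (f z\<^sub>0) r. ball x e)"
    proof (cases "dist (f z\<^sub>0) w \<le> r")
      case True
      then show ?thesis using e by (intro UN_I[of w]) auto
    next
      case False
      \<comment> \<open>The point \<open>x\<close> of the closed disc nearest to \<open>w\<close> is the radial projection of \<open>w\<close>.\<close>
      define t where "t = r / dist (f z\<^sub>0) w"
      have t: "0 < t" "t < 1" "t * dist (f z\<^sub>0) w = r"
      proof -
        have "0 < dist (f z\<^sub>0) w" "r < dist (f z\<^sub>0) w" using False r by linarith+
        then show "0 < t" "t < 1" "t * dist (f z\<^sub>0) w = r" using r by (auto simp: t_def)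
      qed
      define x where "x = f z\<^sub>0 + t *\<^sub>R (w - f z\<^sub>0)"
      have "dist (f z\<^sub>0) x = t * dist (f z\<^sub>0) w"
        using t by (simp add: x_def dist_norm norm_minus_commute)
      moreover have "w - x = (1 - t) *\<^sub>R (w - f z\<^sub>0)"
        by (simp add: x_def algebra_simps)
      then have "dist x w = (1 - t) * dist (f z\<^sub>0) w"
        using t by (simp add: dist_norm norm_minus_commute)
      ultimately show ?thesis
        using w t by (intro UN_I[of x]) (auto simp: algebra_simps)
    qed
    then show "w \<in> f ` N" using e by blast
  qed
  have "z\<^sub>0 \<in> N"
    using z0 N(2) closure_subset[of "g ` ?B"] unfolding L_def by blast
  have "inverse_branch f V z\<^sub>0 (r + e) h"
    unfolding inverse_branch_def
  proof (intro conjI ballI)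
    show "h holomorphic_on ball (f z\<^sub>0) (r + e)" using h(1) ball by (rule holomorphic_on_subset)
    show "h (f z\<^sub>0) = z\<^sub>0" using h(2) \<open>z\<^sub>0 \<in> N\<close> .
    fix w assume "w \<in> ball (f z\<^sub>0) (r + e)"
    then obtain z where "z \<in> N" "w = f z" using ball by blast
    then show "h w \<in> V" "f (h w) = w" using h(2) N(3) by auto
  qed
  then show ?thesis using that[of "r + e"] e by simp
qed

lemma inverse_branch_glue:
  assumes f: "f holomorphic_on V" "open V" and f': "deriv f z\<^sub>0 \<noteq> 0" "z\<^sub>0 \<in> V"
    and R: "0 < R" and ex: "\<And>r. 0 < r \<Longrightarrow> r < R \<Longrightarrow> \<exists>g. inverse_branch f V z\<^sub>0 r g"
  obtains h where "inverse_branch f V z\<^sub>0 R h"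
proof -
  obtain g where g: "\<And>r. 0 < r \<Longrightarrow> r < R \<Longrightarrow> inverse_branch f V z\<^sub>0 r (g r)"
    using ex by metis
  \<comment> \<open>The midpoint is merely a choice of radius strictly between the distance of \<open>w\<close> and \<open>R\<close>.\<close>
  define h where "h = (\<lambda>w. g ((dist (f z\<^sub>0) w + R) / 2) w)"
  have eq: "h w = g r w" if r: "0 < r" "r < R" and w: "w \<in> ball (f z\<^sub>0) r" for r w
  proof -
    let ?q = "(dist (f z\<^sub>0) w + R) / 2"
    have q: "0 < ?q" "?q < R" "dist (f z\<^sub>0) w < ?q"
      using w r R by (auto simp: add_nonneg_pos)
    show ?thesis unfolding h_def
      by (rule inverse_branch_unique[OF f f' _ _ _ g[OF q(1,2)] g[OF r], of "min ?q r"])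
        (use q r w in \<open>auto simp: min_def\<close>)
  qed
  have near: "\<exists>r. 0 < r \<and> r < R \<and> w \<in> ball (f z\<^sub>0) r" if "w \<in> ball (f z\<^sub>0) R" for w
    using that R by (intro exI[of _ "(dist (f z\<^sub>0) w + R) / 2"]) (auto simp: add_nonneg_pos)
  have "inverse_branch f V z\<^sub>0 R h"
    unfolding inverse_branch_def
  proof (intro conjI ballI)
    show "h (f z\<^sub>0) = z\<^sub>0"
      using eq[of "R / 2" "f z\<^sub>0"] g[of "R / 2"] R by (auto simp: inverse_branch_def)
    show "h holomorphic_on ball (f z\<^sub>0) R"
      unfolding holomorphic_on_open[OF open_ball]
    proof
      fix w assume "w \<in> ball (f z\<^sub>0) R"
      then obtain r where r: "0 < r" "r < R" "w \<in> ball (f z\<^sub>0) r" using near by blast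
      have "g r holomorphic_on ball (f z\<^sub>0) r" using g r by (auto simp: inverse_branch_def)
      then have "h holomorphic_on ball (f z\<^sub>0) r"
        using holomorphic_cong[OF refl, of "ball (f z\<^sub>0) r" h "g r"] eq[OF r(1,2)] by blast
      then show "\<exists>f'. (h has_field_derivative f') (at w)"
        using r holomorphic_on_open[OF open_ball] by blast
    qed
  next
    fix w assume "w \<in> ball (f z\<^sub>0) R"
    then obtain r where r: "0 < r" "r < R" "w \<in> ball (f z\<^sub>0) r" using near by blast
    then show "h w \<in> V" "f (h w) = w"
      using eq[OF r] g[OF r(1,2)] by (auto simp: inverse_branch_def)
  qed
  then show ?thesis using that by blast
qed

text \<open>
  The radii at most \<open>R\<close> that admit a branch form an interval which contains its supremum by
  gluing; by extension, the supremum cannot be smaller than \<open>R\<close>. The hypothesis \<open>compact\<close> is the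
  assumption that no singularity obstructs the continuation.
\<close>

lemma inverse_branch_exists:
  assumes f: "f holomorphic_on V" "open V" and f': "\<And>z. z \<in> V \<Longrightarrow> deriv f z \<noteq> 0"
    and z0: "z\<^sub>0 \<in> V" and R: "0 < R"
    and compact: "\<And>r g. 0 < r \<Longrightarrow> r < R \<Longrightarrow> inverse_branch f V z\<^sub>0 r g \<Longrightarrow>
      \<exists>K. compact K \<and> K \<subseteq> V \<and> g ` ball (f z\<^sub>0) r \<subseteq> K"
  obtains g where "inverse_branch f V z\<^sub>0 R g"
proof -
  note df = f'[OF z0] z0
  define S where "S = {r. 0 < r \<and> r \<le> R \<and> (\<exists>g. inverse_branch f V z\<^sub>0 r g)}"
  have mono: "inverse_branch f V z\<^sub>0 r g" if "inverse_branch f V z\<^sub>0 r' g" "r \<le> r'" for r r' g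
    using that unfolding inverse_branch_def
    by (meson holomorphic_on_subset subset_ball subsetD)
  obtain r1 g1 where r1: "0 < r1" "inverse_branch f V z\<^sub>0 r1 g1"
    using inverse_branch_small[OF f df] by blast
  then have S1: "min r1 R \<in> S" using R mono[OF r1(2), of "min r1 R"] unfolding S_def by auto
  have bdd: "bdd_above S" by (rule bdd_aboveI[of _ R]) (auto simp: S_def)
  define r0 where "r0 = Sup S"
  have r0: "0 < r0" "r0 \<le> R"
  proof -
    have "min r1 R \<le> r0" unfolding r0_def by (rule cSup_upper[OF S1 bdd])
    then show "0 < r0" using r1 R by linarith
    show "r0 \<le> R" unfolding r0_def
    proof (rule cSup_least)
      show "S \<noteq> {}" using S1 by blast
    qed (simp add: S_def)
  qed
  have "\<exists>g. inverse_branch f V z\<^sub>0 r g" if "0 < r" "r < r0" for r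
  proof -
    obtain r' where "r' \<in> S" "r < r'"
      using less_cSup_iff[OF _ bdd] S1 \<open>r < r0\<close> unfolding r0_def by blast
    then show ?thesis using mono[of r' _ r] by (auto simp: S_def)
  qed
  then obtain g where g: "inverse_branch f V z\<^sub>0 r0 g"
    using inverse_branch_glue[OF f df r0(1)] by blast
  have "\<not> r0 < R"
  proof
    assume lt: "r0 < R"
    obtain K where "compact K" "K \<subseteq> V" "g ` ball (f z\<^sub>0) r0 \<subseteq> K"
      using compact[OF r0(1) lt g] by blast
    then obtain r' h where r': "r0 < r'" "inverse_branch f V z\<^sub>0 r' h"
      using inverse_branch_extend[OF f f' r0(1) g] by blast
    then have "min r' R \<in> S"
      using r0 R mono[OF r'(2), of "min r' R"] unfolding S_def by auto
    then have "min r' R \<le> r0" unfolding r0_def using bdd by (rule cSup_upper)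
    then show False using r' lt by linarith
  qed
  then show ?thesis using that g r0 by simp
qed

text \<open>
  The image of a section \<open>g\<close> of \<open>f\<close> is open because \<open>g\<close> is injective, and relatively closed
  because it is the set where \<open>g (f z) = z\<close>. If it meets a component, it lies in it by
  connectedness and therefore fills it.
\<close>

lemma component_conformal_isomorphism:
  assumes f: "f holomorphic_on W"
    and C: "C \<in> components W" and D: "open D" "connected D" "f ` W \<subseteq> D"
    and g: "g holomorphic_on D" "\<And>w. w \<in> D \<Longrightarrow> g w \<in> W" "\<And>w. w \<in> D \<Longrightarrow> f (g w) = w"
    and meet: "w\<^sub>0 \<in> D" "g w\<^sub>0 \<in> C"
  shows "conformal_isomorphism C D f"
proof -
  have CW: "C \<subseteq> W" and conn: "connected C"
    using C in_components_subset in_components_connected by blast+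
  have fC: "f holomorphic_on C" using f CW holomorphic_on_subset by blast
  have cont_g: "continuous_on D g" using g holomorphic_on_imp_continuous_on by blast
  have "connected (g ` D)" using cont_g D(2) by (rule connected_continuous_image)
  then have gC: "g ` D \<subseteq> C"
    using components_maximal[OF C] g(2) meet by blast
  have "open (g ` D)"
    using open_mapping_thm3[OF g(1) D(1)] g(3) by (metis inj_on_inverseI)
  then have "openin (top_of_set C) (g ` D)" using gC by (simp add: open_subset)
  moreover have "closedin (top_of_set C) (g ` D)"
  proof -
    have eq: "g ` D = C \<inter> (\<lambda>z. g (f z) - z) -` {0}"
    proof (intro equalityI subsetI)
      fix z assume "z \<in> g ` D"
      then show "z \<in> C \<inter> (\<lambda>z. g (f z) - z) -` {0}" using gC g(3) by auto
    next
      fix z assume "z \<in> C \<inter> (\<lambda>z. g (f z) - z) -` {0}"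
      then show "z \<in> g ` D" using CW D(3) by (intro image_eqI[of _ _ "f z"]) auto
    qed
    have "continuous_on C (\<lambda>z. g (f z) - z)"
      using CW D(3) by (intro continuous_intros continuous_on_compose2[OF cont_g]
          holomorphic_on_imp_continuous_on fC) auto
    then show ?thesis unfolding eq by (rule continuous_closedin_preimage) simp
  qed
  ultimately have "g ` D = C"
    using conn meet unfolding connected_clopen by blast
  then show ?thesis
    unfolding conformal_isomorphism_def
    using fC g D(3) CW by (intro conjI exI[of _ g]) auto
qed

section \<open>Lengths of lifted segments\<close>

text \<open>
  The lift \<open>\<gamma>\<close> under \<open>g\<close> of the segment from the centre to \<open>w\<close> joins \<open>z\<^sub>0\<close> to \<open>g w\<close>. By the chain rule
  \<open>\<bar>f' (\<gamma> t)\<bar> * \<bar>\<gamma>' t\<bar>\<close> is the constant speed of the segment, and \<open>\<rho>\<close> is at most \<open>\<bar>f'\<bar> / c\<close>.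
\<close>

lemma metric_dist_inverse_branch_le:
  assumes f: "f holomorphic_on V" "open V" and c: "0 < c"
    and \<rho>: "\<And>z. z \<in> V \<Longrightarrow> c * \<rho> z \<le> norm (deriv f z)"
    and g: "inverse_branch f V z\<^sub>0 r g" and w: "w \<in> ball (f z\<^sub>0) r"
  shows "metric_dist V \<rho> z\<^sub>0 (g w) \<le> ennreal (dist (f z\<^sub>0) w / c)"
proof -
  let ?l = "linepath (f z\<^sub>0) w"
  let ?C = "dist (f z\<^sub>0) w / c"
  have cen: "f z\<^sub>0 \<in> ball (f z\<^sub>0) r" using w by (auto intro: le_less_trans[OF zero_le_dist])
  have img: "path_image ?l \<subseteq> ball (f z\<^sub>0) r"
    using closed_segment_subset[OF cen w convex_ball] by simp
  have gh: "g holomorphic_on ball (f z\<^sub>0) r" "g (f z\<^sub>0) = z\<^sub>0"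
    "\<And>w. w \<in> ball (f z\<^sub>0) r \<Longrightarrow> g w \<in> V"
    using g by (auto simp: inverse_branch_def)
  define \<gamma> where "\<gamma> = g \<circ> ?l"
  have bound: "\<rho> (\<gamma> t) * norm (vector_derivative \<gamma> (at t)) \<le> ?C" if t: "t \<in> {0..1}" for t
  proof -
    have lt: "?l t \<in> ball (f z\<^sub>0) r"
      using img t unfolding path_image_def by blast
    have "(?l has_vector_derivative (w - f z\<^sub>0)) (at t)"
      by (rule has_vector_derivative_linepath_within)
    moreover have "(g has_field_derivative deriv g (?l t)) (at (?l t))"
      using gh(1) lt by (auto intro: holomorphic_derivI)
    ultimately have "(\<gamma> has_vector_derivative (w - f z\<^sub>0) * deriv g (?l t)) (at t)"
      unfolding \<gamma>_def by (intro field_vector_diff_chain_at)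
    then have vd: "norm (vector_derivative \<gamma> (at t)) = dist (f z\<^sub>0) w * norm (deriv g (?l t))"
      by (simp add: vector_derivative_at norm_mult dist_norm norm_minus_commute)
    have "norm (deriv f (\<gamma> t)) * norm (deriv g (?l t)) = 1"
      using inverse_branch_deriv[OF f g lt] by (metis \<gamma>_def comp_apply norm_mult norm_one)
    moreover have "c * \<rho> (\<gamma> t) \<le> norm (deriv f (\<gamma> t))"
      using \<rho> gh(3)[OF lt] by (simp add: \<gamma>_def)
    ultimately have "c * \<rho> (\<gamma> t) * norm (deriv g (?l t)) \<le> 1"
      by (metis mult_right_mono norm_ge_zero)
    then have "dist (f z\<^sub>0) w * (c * \<rho> (\<gamma> t) * norm (deriv g (?l t))) \<le> dist (f z\<^sub>0) w"
      using mult_left_mono[of _ 1 "dist (f z\<^sub>0) w"] by simp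
    then show ?thesis unfolding vd using c by (simp add: field_simps)
  qed
  have "metric_dist V \<rho> z\<^sub>0 (g w) \<le> metric_length \<rho> \<gamma>"
    unfolding metric_dist_def
  proof (rule INF_lower, safe)
    show "valid_path \<gamma>" unfolding \<gamma>_def
      using valid_path_compose_holomorphic[OF valid_path_linepath gh(1) open_ball img] .
    show "pathstart \<gamma> = z\<^sub>0" "pathfinish \<gamma> = g w"
      using gh(2) by (auto simp: \<gamma>_def pathstart_compose pathfinish_compose)
    show "z \<in> V" if "z \<in> path_image \<gamma>" for z
      using that img gh(3) by (auto simp: \<gamma>_def path_image_compose)
  qed
  also have "\<dots> \<le> (\<integral>\<^sup>+ t. ennreal ?C * indicator {0..1::real} t \<partial>lborel)"
    unfolding metric_length_def
    by (intro nn_integral_mono) (auto simp: indicator_def intro!: ennreal_leI bound)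
  also have "\<dots> = ennreal ?C"
    by (subst nn_integral_cmult_indicator) auto
  finally show ?thesis .
qed

text \<open>This is how completeness at infinity is used: metric balls are bounded in the plane.\<close>

lemma bounded_metric_ball:
  assumes "metric_dist_infinity V \<rho> z = \<infinity>" and "L < \<infinity>"
  shows "bounded {w \<in> V. metric_dist V \<rho> z w \<le> L}"
proof -
  have "\<forall>\<^sub>F w in inf at_infinity (principal V). L < metric_dist V \<rho> z w"
    using assms unfolding metric_dist_infinity_def by (metis less_LiminfD)
  then obtain b where b: "\<And>w. b \<le> norm w \<Longrightarrow> w \<in> V \<Longrightarrow> L < metric_dist V \<rho> z w"
    unfolding eventually_inf_principal eventually_at_infinity by blast
  have "norm w \<le> b" if "w \<in> V" "metric_dist V \<rho> z w \<le> L" for w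
    using b[of w] that by (meson leD linear)
  then show ?thesis by (auto simp: bounded_iff)
qed

section \<open>Preimages under meromorphic functions\<close>

context
  fixes f :: "complex \<Rightarrow> complex"
  assumes f: "f nicely_meromorphic_on UNIV"
begin

lemma mero_vimage_analytic: "f analytic_on mero_vimage f U"
  using nicely_meromorphic_on_imp_analytic_at[OF f]
  by (subst analytic_on_analytic_at) (auto simp: mero_vimage_def)

lemma open_mero_vimage:
  assumes "open U"
  shows "open (mero_vimage f U)"
proof (subst open_subopen, intro ballI)
  fix z assume z: "z \<in> mero_vimage f U"
  then have "f analytic_on {z}"
    using mero_vimage_analytic analytic_on_analytic_at by blast
  then obtain S where S: "open S" "z \<in> S" "f holomorphic_on S"
    using analytic_at by blast
  have "open (S \<inter> f -` U)"
    using S assms by (intro continuous_open_preimage holomorphic_on_imp_continuous_on)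
  moreover have "S \<inter> f -` U \<subseteq> mero_vimage f U"
    using S not_is_pole_holomorphic by (auto simp: mero_vimage_def)
  moreover have "z \<in> S \<inter> f -` U" using z S by (auto simp: mero_vimage_def)
  ultimately show "\<exists>T. open T \<and> z \<in> T \<and> T \<subseteq> mero_vimage f U" by blast
qed

text \<open>
  Compactness of \<open>D\<close> matters: the preimage of an unbounded closed set may accumulate at a pole.
\<close>

lemma closed_mero_vimage:
  assumes "compact D"
  shows "closed (mero_vimage f D)"
  unfolding closed_sequential_limits
proof (intro allI impI, elim conjE)
  fix x l assume x: "\<forall>n. x n \<in> mero_vimage f D" and lim: "x \<longlonglongrightarrow> l"
  have fD: "f (x n) \<in> D" and np: "\<not> is_pole f (x n)" for n
    using x by (auto simp: mero_vimage_def)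
  have nl: "\<not> is_pole f l"
  proof
    assume pole: "is_pole f l"
    then have "x n \<noteq> l" for n using np by metis
    then have "filterlim x (at l) sequentially"
      using lim by (simp add: filterlim_at)
    then have "filterlim (\<lambda>n. f (x n)) at_infinity sequentially"
      using pole unfolding is_pole_def by (rule filterlim_compose[rotated])
    then have unbounded: "\<forall>\<^sub>F n in sequentially. b < norm (f (x n))" for b
      by (simp add: filterlim_at_infinity_conv_norm_at_top filterlim_at_top_dense)
    obtain B where B: "\<forall>w\<in>D. norm w \<le> B"
      using compact_imp_bounded[OF assms] unfolding bounded_iff by blast
    obtain n where "B < norm (f (x n))"
      using eventually_happens[OF unbounded[of B]] by auto
    then show False using B fD[of n] by force
  qed
  then have "isCont f l"
    using nicely_meromorphic_on_imp_analytic_at[OF f UNIV_I] analytic_at_imp_isCont by blast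
  then have "(\<lambda>n. f (x n)) \<longlonglongrightarrow> f l" using lim by (rule isCont_tendsto_compose)
  then have "f l \<in> D"
    using closed_sequentially[OF compact_imp_closed[OF assms], of "\<lambda>n. f (x n)"] fD by blast
  with nl show "l \<in> mero_vimage f D" by (simp add: mero_vimage_def)
qed

section \<open>Regular values\<close>

text \<open>
  The range of a branch on a disc inside \<open>U\<close> lies in a metric ball, so it is bounded; the
  closure of the range stays in the preimage of a closed disc inside \<open>U\<close>. This is the
  compactness needed to continue branches throughout discs in \<open>U\<close>.
\<close>

proposition regular_value_if_derivative_dominates_metric:
  assumes U: "open U" "s \<in> U"
    and inf: "\<And>z. z \<in> mero_vimage f U \<Longrightarrow> metric_dist_infinity (mero_vimage f U) \<rho> z = \<infinity>"
    and \<rho>: "\<And>z. z \<in> mero_vimage f U \<Longrightarrow> 0 < \<rho> z"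
    and c: "0 < c" "\<And>z. z \<in> mero_vimage f U \<Longrightarrow> c * \<rho> z \<le> norm (deriv f z)"
  shows "regular_value f s"
proof -
  define V where "V = mero_vimage f U"
  have V: "f holomorphic_on V" "open V"
    using mero_vimage_analytic open_mero_vimage[OF U(1)] analytic_imp_holomorphic
    by (auto simp: V_def)
  have f': "deriv f z \<noteq> 0" if "z \<in> V" for z
    using c \<rho>[of z] that by (force simp: V_def mult_le_0_iff)
  obtain e where e: "e > 0" "ball s e \<subseteq> U" using U by (meson openE)
  \<comment> \<open>Branches are centred at arbitrary points \<open>f z0\<close> of \<open>ball s r\<close>. The radius \<open>e / 3\<close> gives
    \<open>ball s r \<subseteq> ball (f z0) (2 * r) \<subseteq> ball s e\<close>.\<close>
  define r where "r = e / 3"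
  let ?D = "ball s r" and ?W = "mero_vimage f (ball s r)"
  have r: "r > 0" using e by (simp add: r_def)
  have W: "f holomorphic_on ?W"
    using mero_vimage_analytic by (rule analytic_imp_holomorphic)
  have "conformal_isomorphism C ?D f" if C: "C \<in> components ?W" for C
  proof -
    obtain z0 where z0: "z0 \<in> C" using C in_components_nonempty by blast
    then have "z0 \<in> ?W" using C in_components_subset by blast
    then have fz0: "f z0 \<in> ?D" by (simp add: mero_vimage_def)
    have big: "ball (f z0) (2 * r) \<subseteq> U"
    proof
      fix w assume "w \<in> ball (f z0) (2 * r)"
      then have "dist s w < e"
        using fz0 dist_triangle[of s w "f z0"] by (simp add: r_def)
      then show "w \<in> U" using e by auto
    qed
    have z0V: "z0 \<in> V"
      using \<open>z0 \<in> ?W\<close> big r by (auto simp: V_def mero_vimage_def subset_iff)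
    obtain g where g: "inverse_branch f V z0 (2 * r) g"
    proof (rule inverse_branch_exists[OF V f' z0V, of "2 * r"])
      show "0 < 2 * r" using r by simp
      fix q g assume q: "0 < q" "q < 2 * r" and g: "inverse_branch f V z0 q g"
      let ?L = "ennreal (q / c)"
      define K where "K = closure (g ` ball (f z0) q)"
      have "g ` ball (f z0) q \<subseteq> {w \<in> V. metric_dist V \<rho> z0 w \<le> ?L}"
      proof safe
        fix w assume w: "w \<in> ball (f z0) q"
        then show "g w \<in> V" using g by (auto simp: inverse_branch_def)
        have "metric_dist V \<rho> z0 (g w) \<le> ennreal (dist (f z0) w / c)"
          using metric_dist_inverse_branch_le[OF V c(1) _ g w] c(2) by (simp add: V_def)
        also have "\<dots> \<le> ?L"
          using w c by (intro ennreal_leI divide_right_mono) auto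
        finally show "metric_dist V \<rho> z0 (g w) \<le> ?L" .
      qed
      moreover have "bounded {w \<in> V. metric_dist V \<rho> z0 w \<le> ?L}"
        by (rule bounded_metric_ball) (use inf z0V in \<open>auto simp: V_def\<close>)
      ultimately have "compact K"
        unfolding K_def by (meson bounded_subset compact_closure)
      moreover have "K \<subseteq> V"
      proof -
        have "g ` ball (f z0) q \<subseteq> mero_vimage f (cball (f z0) q)"
          using g by (auto simp: inverse_branch_def V_def mero_vimage_def)
        then have "K \<subseteq> mero_vimage f (cball (f z0) q)"
          unfolding K_def using closed_mero_vimage[OF compact_cball] by (rule closure_minimal)
        moreover have "cball (f z0) q \<subseteq> U"
          using big q by (auto simp: subset_iff)
        ultimately show ?thesis unfolding V_def mero_vimage_def by blast
      qed
      ultimately show "\<exists>K. compact K \<and> K \<subseteq> V \<and> g ` ball (f z0) q \<subseteq> K"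
        using closure_subset[of "g ` ball (f z0) q"] by (intro exI[of _ K]) (auto simp: K_def)
    qed
    have D: "?D \<subseteq> ball (f z0) (2 * r)"
    proof
      fix w assume "w \<in> ?D"
      then show "w \<in> ball (f z0) (2 * r)"
        using fz0 dist_triangle[of "f z0" w s] by (simp add: dist_commute)
    qed
    show ?thesis
    proof (rule component_conformal_isomorphism[OF W C open_ball connected_ball, of s r g "f z0"])
      show "g holomorphic_on ?D"
        using g D holomorphic_on_subset unfolding inverse_branch_def by blast
      show "f ` ?W \<subseteq> ?D" by (auto simp: mero_vimage_def)
      show fg: "f (g w) = w" if "w \<in> ?D" for w
        using g D that by (auto simp: inverse_branch_def)
      show "g w \<in> ?W" if "w \<in> ?D" for w
        using g D that fg[OF that] by (auto simp: inverse_branch_def V_def mero_vimage_def)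
      show "f z0 \<in> ?D" by fact
      show "g (f z0) \<in> C" using g z0 by (simp add: inverse_branch_def)
    qed
  qed
  then show ?thesis
    unfolding regular_value_def using r by (intro exI[of _ ?D]) auto
qed

end

theorem theorem1p4:
  fixes f :: "complex \<Rightarrow> complex" and s :: complex
    and U V :: "complex set" and \<rho> :: "complex \<Rightarrow> real"
  assumes "transcendental_entire f \<or> transcendental_meromorphic f"
    and "s \<in> singular_values f"
    and "open U" and "s \<in> U"
    and "V = mero_vimage f U"
    and "conformal_metric_on V \<rho>"
    and "\<And>z. z \<in> V \<Longrightarrow> metric_dist_infinity V \<rho> z = \<infinity>"
  shows "(INF z\<in>V. norm (deriv f z) / \<rho> z) = 0"
proof (rule ccontr)
  let ?q = "\<lambda>z. norm (deriv f z) / \<rho> z"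
  define c where "c = (INF z\<in>V. ?q z)"
  assume "(INF z\<in>V. ?q z) \<noteq> 0"
  have f: "f nicely_meromorphic_on UNIV"
    using assms(1) unfolding transcendental_entire_def transcendental_meromorphic_def
    by (auto intro: analytic_on_imp_nicely_meromorphic_on simp: analytic_on_open)
  have singular: "\<not> regular_value f s"
    using assms(2) by (simp add: singular_values_def)
  have \<rho>: "0 < \<rho> z" if "z \<in> V" for z
    using assms(6) that by (simp add: conformal_metric_on_def)
  \<comment> \<open>The infimum is taken in the reals, so it is meaningful only for nonempty \<open>V\<close>. A value
    \<open>s\<close> with empty preimage of \<open>U\<close> is vacuously regular.\<close>
  have "V \<noteq> {}"
  proof
    assume "V = {}"
    then have "components (mero_vimage f U) = {}" using assms(5) by simp
    then show False
      using singular assms(3,4) unfolding regular_value_def by blast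
  qed
  have nonneg: "0 \<le> ?q z" if "z \<in> V" for z
    using \<rho>[OF that] by simp
  have "0 \<le> c" unfolding c_def using \<open>V \<noteq> {}\<close> nonneg by (rule cINF_greatest)
  then have "0 < c" using \<open>(INF z\<in>V. ?q z) \<noteq> 0\<close> by (simp add: c_def)
  have "bdd_below (?q ` V)" using nonneg by (intro bdd_belowI2)
  then have c_le: "c \<le> ?q z" if "z \<in> V" for z
    unfolding c_def using that by (rule cINF_lower)
  have "c * \<rho> z \<le> norm (deriv f z)" if "z \<in> V" for z
    using \<rho>[OF that] c_le[OF that] by (simp add: field_simps)
  then show False
    using regular_value_if_derivative_dominates_metric[OF f assms(3,4), of \<rho> c] singular
      assms(5,7) \<rho> \<open>0 < c\<close> by auto
qed

end
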